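(* Let $f:\mathbb{R}^n\to(-\infty,\infty]$ and $g:\mathbb{R}^m\to(-\infty,\infty]$ be proper and lower semicontinuous, let $F:\mathbb{R}^n\times\mathbb{R}^m\to\mathbb{R}$ be $C^1$, and let $\Psi(x,y)=f(x)+g(y)+F(x,y)$. Suppose that $\Psi$ is a generalized concave KL function and that assumptions (A1)–(A4) listed in the context hold. Let $(z_k)_{k\in\mathbb{N}}=(x_k,y_k)_{k\in\mathbb{N}}$ be a sequence generated by the PALM algorithm (described in the context) which is assumed to be bounded. Then the following assertions hold: (i) The sequence $(z_k)_{k\in\mathbb{N}}$ converges to a stationary point $z^*$ of the objective function $\Psi$ (i.e. $0\in\partial\Psi(z^* )$). (ii) The sequence $(z_k)_{k\in\mathbb{N}}$ has finite length. More precisely, there exist $l\in\mathbb{N}$, $\eta\in(0,\infty]$ and $\tilde{\varphi}\in\Phi_\eta$ such that for every $p\geq l+1$ and every $q\in\mathbb{N}$, $$\sum_{k=p}^{p+q}\|z_{k+1}-z_k\|\leq C\cdot\tilde{\varphi}\big(\Psi(z_p)-\Psi(z^* )\big)+\|z_p-z_{p-1}\|.$$ Therefore $$\sum_{k=1}^\infty\|z_{k+1}-z_k\|\leq A+C\cdot\tilde{\varphi}\big(\Psi(z_{l+1})-\Psi(z^* )\big)<\infty,$$ where $A=\|z_{l+1}-z_{l}\|+\sum_{k=1}^{l}\|z_{k+1}-z_k\|<\infty$ and $C=2(2M+3\rho_2)/\rho_1$, with the constants $M,\rho_1,\rho_2$ defined in the context.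
   Context: $\mathbb{N}=\{1,2,3,\dots\}$, $\mathbb{R}_+=[0,\infty)$. For $\eta\in(0,\infty]$, $\Phi_\eta$ is the class of functions $\varphi:[0,\eta)\to\mathbb{R}_+$ that are strictly increasing on $[0,\eta)$ and right-continuous at $0$ with $\varphi(0)=0$. $\varphi'_-$ denotes the left derivative. $\partial$ is the limiting subdifferential: $v\in\hat\partial \Psi(x)$ for $x\in\operatorname{dom}\Psi$ if $\Psi(y)\ge \Psi(x)+\langle v,y-x\rangle+o(\|y-x\|)$; $v\in\partial \Psi(x)$ if there are $x_k\to x$ with $\Psi(x_k)\to \Psi(x)$ and $v_k\in\hat\partial \Psi(x_k)$, $v_k\to v$. $\operatorname{dom}\partial\Psi=\{x:\partial\Psi(x)\neq\emptyset\}$, and $\operatorname{dist}(0,\emptyset)=\infty$. A proper lower semicontinuous function $\Psi$ is a generalized concave KL function if at every $\bar x\in\operatorname{dom}\partial \Psi$ it has the pointwise generalized concave KL property: there exist a neighborhood $U\ni\bar x$, $\eta\in(0,\infty]$ and a concave $\varphi\in\Phi_\eta$ such that $\varphi'_-(\Psi(x)-\Psi(\bar x))\cdot\operatorname{dist}(0,\partial \Psi(x))\ge1$ for all $x\in U$ with $0<\Psi(x)-\Psi(\bar x)<\eta$. Proximal mapping: $\operatorname{Prox}_\lambda^f(x)=\operatorname{argmin}_{y}\{f(y)+\frac{\lambda}{2}\|x-y\|^2\}$ for $\lambda>0$ (a set-valued mapping). PALM algorithm: fix $\gamma_1>1$, $\gamma_2>1$ and start with arbitrary $z_0=(x_0,y_0)\in\mathbb{R}^n\times\mathbb{R}^m$.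 For $k=0,1,\dots$, set $c_k=\gamma_1L_1(y_k)$ and choose $$x_{k+1}\in\operatorname{Prox}^f_{c_k}\Big(x_k-\tfrac{1}{c_k}\nabla_xF(x_k,y_k)\Big);$$ then set $d_k=\gamma_2L_2(x_{k+1})$ and choose $$y_{k+1}\in\operatorname{Prox}^g_{d_k}\Big(y_k-\tfrac{1}{d_k}\nabla_yF(x_{k+1},y_k)\Big);$$ $z_{k+1}=(x_{k+1},y_{k+1})$. Here $L_1(y)$, $L_2(x)$ are the Lipschitz moduli in (A2). Assumptions: (A1) $\inf_{\mathbb{R}^n\times\mathbb{R}^m}\Psi>-\infty$, $\inf_{\mathbb{R}^n}f>-\infty$ and $\inf_{\mathbb{R}^m}g>-\infty$. (A2) For every fixed $y\in\mathbb{R}^m$, $x\mapsto F(x,y)$ is $C^{1,1}_{L_1(y)}$, i.e. $\|\nabla_xF(x_1,y)-\nabla_xF(x_2,y)\|\le L_1(y)\|x_1-x_2\|$ for all $x_1,x_2\in\mathbb{R}^n$; similarly, for every fixed $x\in\mathbb{R}^n$, $y\mapsto F(x,y)$ is $C^{1,1}_{L_2(x)}$. (A3) For $i=1,2$ there exist $\lambda_i^-,\lambda_i^+>0$ such that $\inf\{L_1(y_k):k\in\mathbb{N}\}\ge\lambda_1^-$, $\inf\{L_2(x_k):k\in\mathbb{N}\}\ge\lambda_2^-$, $\sup\{L_1(y_k):k\in\mathbb{N}\}\le\lambda_1^+$, $\sup\{L_2(x_k):k\in\mathbb{N}\}\le\lambda_2^+$. (A4) $\nabla F$ is Lipschitz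 continuous on bounded subsets of $\mathbb{R}^n\times\mathbb{R}^m$: on every bounded subset $B_1\times B_2$ there is $M>0$ with $\|\nabla F(x_1,y_1)-\nabla F(x_2,y_2)\|\le M\|(x_1-x_2,y_1-y_2)\|$ for all $(x_i,y_i)\in B_1\times B_2$, $i=1,2$. Constants: $M>0$ is the Lipschitz constant of $\nabla F$ from (A4) on a bounded set $B_1\times B_2$ containing all the iterates $z_k$; $\rho_1=\min\{(\gamma_1-1)\lambda_1^-,(\gamma_2-1)\lambda_2^-\}$; $\rho_2=\max\{\gamma_1\lambda_1^+,\gamma_2\lambda_2^+\}$. *)

theory Defs
  imports "HOL-Analysis.Analysis" "HOL-Library.Landau_Symbols"
begin

definition proper :: "('a \<Rightarrow> ereal) \<Rightarrow> bool" where
  "proper f \<longleftrightarrow> (\<forall>x. f x \<noteq> -\<infinity>) \<and> (\<exists>x. f x \<noteq> \<infinity>)"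

definition lsc :: "('a::topological_space \<Rightarrow> ereal) \<Rightarrow> bool" where
  "lsc f \<longleftrightarrow> (\<forall>x. f x \<le> Liminf (at x) f)"

text \<open>Both subdifferentials are empty at points where the function is not finite. The remainder
  \<open>r\<close> is the \<open>o\<close>-term in \<open>f y \<ge> f x + \<langle>v, y - x\<rangle> + o(\<parallel>y - x\<parallel>)\<close>.\<close>

definition regular_subdiff :: "('a::real_inner \<Rightarrow> ereal) \<Rightarrow> 'a \<Rightarrow> 'a set" where
  "regular_subdiff f x = {v. \<bar>f x\<bar> \<noteq> \<infinity> \<and>
     (\<exists>r :: 'a \<Rightarrow> real. r \<in> o[at x](\<lambda>y. norm (y - x)) \<and>
        (\<forall>\<^sub>F y in at x. f y \<ge> f x + ereal (v \<bullet> (y - x) + r y)))}"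

definition limiting_subdiff :: "('a::real_inner \<Rightarrow> ereal) \<Rightarrow> 'a \<Rightarrow> 'a set" where
  "limiting_subdiff f x = {v. \<bar>f x\<bar> \<noteq> \<infinity> \<and>
     (\<exists>xs vs. xs \<longlonglongrightarrow> x \<and> (\<lambda>k. f (xs k)) \<longlonglongrightarrow> f x \<and>
        (\<forall>k. vs k \<in> regular_subdiff f (xs k)) \<and> vs \<longlonglongrightarrow> v)}"

text \<open>Unlike the library's real-valued \<open>infdist\<close>, the distance to the empty set is \<open>\<infinity>\<close>.\<close>

definition edist_set :: "'a::metric_space \<Rightarrow> 'a set \<Rightarrow> ereal" where
  "edist_set x S = (INF v\<in>S. ereal (dist x v))"

text \<open>The interval \<open>[0, \<eta>)\<close> for \<open>\<eta> \<in> (0, \<infinity>]\<close>. A function on it is represented by a total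
  function on the reals whose values elsewhere are irrelevant.\<close>

definition dom_upto :: "ereal \<Rightarrow> real set" where
  "dom_upto \<eta> = {t. 0 \<le> t \<and> ereal t < \<eta>}"

definition Phi :: "ereal \<Rightarrow> (real \<Rightarrow> real) set" where
  "Phi \<eta> = {\<phi>. (\<forall>t\<in>dom_upto \<eta>. 0 \<le> \<phi> t) \<and> strict_mono_on (dom_upto \<eta>) \<phi> \<and>
               continuous (at_right 0) \<phi> \<and> \<phi> 0 = 0}"

text \<open>Only used for concave functions in the interior of their domain, where the left
  derivative exists.\<close>

definition left_deriv :: "(real \<Rightarrow> real) \<Rightarrow> real \<Rightarrow> real" where
  "left_deriv \<phi> t = (THE D. (\<phi> has_real_derivative D) (at_left t))"

definition gen_concave_KL_at :: "('a::real_inner \<Rightarrow> ereal) \<Rightarrow> 'a \<Rightarrow> bool" where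
  "gen_concave_KL_at \<Psi> x\<^sub>0 \<longleftrightarrow>
     (\<exists>U \<eta> \<phi>. open U \<and> x\<^sub>0 \<in> U \<and> 0 < \<eta> \<and> \<phi> \<in> Phi \<eta> \<and> concave_on (dom_upto \<eta>) \<phi> \<and>
        (\<forall>x\<in>U. 0 < \<Psi> x - \<Psi> x\<^sub>0 \<and> \<Psi> x - \<Psi> x\<^sub>0 < \<eta> \<longrightarrow>
           ereal (left_deriv \<phi> (real_of_ereal (\<Psi> x - \<Psi> x\<^sub>0))) *
             edist_set 0 (limiting_subdiff \<Psi> x) \<ge> 1))"

definition gen_concave_KL :: "('a::real_inner \<Rightarrow> ereal) \<Rightarrow> bool" where
  "gen_concave_KL \<Psi> \<longleftrightarrow> proper \<Psi> \<and> lsc \<Psi> \<and>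
     (\<forall>x\<^sub>0. limiting_subdiff \<Psi> x\<^sub>0 \<noteq> {} \<longrightarrow> gen_concave_KL_at \<Psi> x\<^sub>0)"

definition grad :: "('a::real_inner \<Rightarrow> real) \<Rightarrow> 'a \<Rightarrow> 'a" where
  "grad F z = (THE D. GDERIV F z :> D)"

definition C1_fun :: "('a::real_inner \<Rightarrow> real) \<Rightarrow> bool" where
  "C1_fun F \<longleftrightarrow> (\<forall>z. F differentiable (at z)) \<and> continuous_on UNIV (grad F)"

definition grad_x :: "('a::real_inner \<times> 'b \<Rightarrow> real) \<Rightarrow> 'a \<Rightarrow> 'b \<Rightarrow> 'a" where
  "grad_x F x y = grad (\<lambda>x'. F (x', y)) x"

definition grad_y :: "('a \<times> 'b::real_inner \<Rightarrow> real) \<Rightarrow> 'a \<Rightarrow> 'b \<Rightarrow> 'b" where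
  "grad_y F x y = grad (\<lambda>y'. F (x, y')) y"

definition prox :: "('a::real_normed_vector \<Rightarrow> ereal) \<Rightarrow> real \<Rightarrow> 'a \<Rightarrow> 'a set" where
  "prox f c x = {p. is_arg_min (\<lambda>y. f y + ereal (c / 2 * (norm (x - y))\<^sup>2)) (\<lambda>_. True) p}"

text \<open>The step parameters are required to be positive because the proximal mapping is only
  meaningful for positive parameters.\<close>

definition palm_sequence ::
  "('a::real_inner \<Rightarrow> ereal) \<Rightarrow> ('b::real_inner \<Rightarrow> ereal) \<Rightarrow> ('a \<times> 'b \<Rightarrow> real) \<Rightarrow>
   ('b \<Rightarrow> real) \<Rightarrow> ('a \<Rightarrow> real) \<Rightarrow> real \<Rightarrow> real \<Rightarrow> (nat \<Rightarrow> 'a) \<Rightarrow> (nat \<Rightarrow> 'b) \<Rightarrow> bool" where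
  "palm_sequence f g F L1 L2 \<gamma>1 \<gamma>2 x y \<longleftrightarrow>
     (\<forall>k. let c = \<gamma>1 * L1 (y k); d = \<gamma>2 * L2 (x (Suc k)) in
        c > 0 \<and> x (Suc k) \<in> prox f c (x k - (1 / c) *\<^sub>R grad_x F (x k) (y k)) \<and>
        d > 0 \<and> y (Suc k) \<in> prox g d (y k - (1 / d) *\<^sub>R grad_y F (x (Suc k)) (y k)))"

end

theory Submission
  imports Defs
begin

text \<open>Each half step of PALM minimises a quadratic perturbation of \<open>f\<close> or \<open>g\<close>, so it comes with a global
  quadratic minorant that is exact at the new iterate (\<open>prox_minorant\<close>). Three facts about the
  sequence \<open>z\<close> follow. Evaluated at the previous iterate and combined with the descent lemma for \<open>F\<close>,
  the minorants give the decrease \<open>\<Psi> (z (k + 1)) + \<rho>1 / 2 * \<parallel>z (k + 1) - z k\<parallel>\<^sup>2 \<le> \<Psi> (z k)\<close>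
  (\<open>palm_descent\<close>), because the step parameters exceed the Lipschitz moduli by at least \<open>\<rho>1\<close>. Read
  infinitesimally, they give a regular subgradient of \<open>\<Psi>\<close> at \<open>z (k + 1)\<close> of norm at most
  \<open>b * \<parallel>z (k + 1) - z k\<parallel>\<close> with \<open>b = 2 * M + 3 * \<rho>2\<close> (\<open>palm_residual_bound\<close>,
  \<open>quad_minorant_imp_regular_subdiff\<close>). Evaluated at a cluster point, they show that \<open>\<Psi>\<close> is upper
  semicontinuous along the subsequences that converge to it (\<open>quad_minorant_Limsup_le\<close>).

  These three facts imply convergence for any bounded sequence
  (\<open>KL_descent_sequence_converges\<close>). The values decrease to \<open>\<Psi> w\<close> at a cluster point \<open>w\<close>, and the
  subgradients at the selected iterates tend to zero, so \<open>w\<close> is stationary. Near \<open>w\<close> the concave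
  function \<open>\<phi>\<close> of the Kurdyka-Lojasiewicz inequality transforms the gaps \<open>t k = \<Psi> (z k) - \<Psi> w\<close> so
  that they control lengths (\<open>KL_step_estimate\<close>):
  \<open>2 * \<parallel>z (k + 1) - z k\<parallel> \<le> C * (\<phi> (t k) - \<phi> (t (k + 1))) + \<parallel>z k - z (k - 1)\<parallel>\<close> with
  \<open>C = 2 * b / \<rho>1\<close>. Telescoping bounds the length of any stretch of the sequence that stays near \<open>w\<close>
  by \<open>C * \<phi> (t p) + \<parallel>z p - z (p - 1)\<parallel>\<close>, where \<open>p\<close> is its first index. This bound is small when the stretch
  starts late at an iterate close to \<open>w\<close>, so the sequence never leaves the neighbourhood. Hence
  its length is finite and it converges to \<open>w\<close>. Since the argument is local around one cluster
  point, the function \<open>\<phi>\<close> that the inequality provides at \<open>w\<close> is also the one in the length bound.\<close>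

section \<open>Left derivatives of concave functions\<close>

text \<open>The difference quotients of a concave function at \<open>t\<close> decrease as \<open>s\<close> increases to \<open>t\<close>, and the
  slope of a chord to the right of \<open>t\<close> bounds them from below. Hence they converge to their
  infimum, which is the left derivative; the inequality says that an infimum is a lower bound.
  The point \<open>b\<close> to the right of \<open>t\<close> keeps the left derivative finite.\<close>

lemma concave_left_deriv:
  fixes \<phi> :: "real \<Rightarrow> real"
  assumes conc: "concave_on I \<phi>" and a: "a \<in> I" "a < t" and b: "b \<in> I" "t < b"
    and s: "s \<in> I" "s \<le> t"
  shows "left_deriv \<phi> t * (t - s) \<le> \<phi> t - \<phi> s"
proof -
  define q where "q s = (\<phi> t - \<phi> s) / (t - s)" for s
  have cvx: "convex_on I (\<lambda>s. - \<phi> s)"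
    using conc by (simp add: concave_on_def)
  have conn: "s \<in> I" if "u \<in> I" "v \<in> I" "u \<le> s" "s \<le> v" for s u v
    using concave_on_imp_convex[OF conc] that
    by (metis is_interval_convex_1 mem_is_interval_1_I)
  have tI: "t \<in> I"
    using conn[of a b t] a b by auto
  have q_anti: "q v \<le> q u" if "u \<in> I" "u < v" "v < t" for u v
  proof -
    have "(- \<phi> u - - \<phi> t) / (u - t) \<le> (- \<phi> v - - \<phi> t) / (v - t)"
      by (rule convex_on_slope_le(2)[OF cvx \<open>u \<in> I\<close> tI]) (use that in auto)
    thus ?thesis
      using that by (simp add: q_def field_simps)
  qed
  have q_low: "(\<phi> b - \<phi> t) / (b - t) \<le> q u" if "u \<in> I" "u < t" for u
  proof -
    have "(- \<phi> u - - \<phi> t) / (u - t) \<le> (- \<phi> u - - \<phi> b) / (u - b)"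
      and "(- \<phi> u - - \<phi> b) / (u - b) \<le> (- \<phi> t - - \<phi> b) / (t - b)"
      using convex_on_slope_le[OF cvx \<open>u \<in> I\<close> \<open>b \<in> I\<close>, of t] that b by auto
    hence "(- \<phi> u - - \<phi> t) / (u - t) \<le> (- \<phi> t - - \<phi> b) / (t - b)"
      by linarith
    thus ?thesis
      using that b by (simp add: q_def field_simps)
  qed
  define J where "J = {s \<in> I. s < t}"
  define D where "D = (INF s\<in>J. q s)"
  have bdd: "bdd_below (q ` J)"
    using q_low by (auto simp: J_def intro!: bdd_belowI2)
  have aJ: "a \<in> J"
    using a by (simp add: J_def)
  have D_le: "D \<le> q s" if "s \<in> J" for s
    unfolding D_def using bdd that by (rule cINF_lower)
  have near: "\<forall>\<^sub>F s in at_left t. s \<in> J \<and> u < s" if "u \<in> J" for u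
    using eventually_at_left_field[of "\<lambda>s. s \<in> J \<and> u < s" t] conn[OF _ tI, of u] that
    by (auto simp: J_def intro!: exI[of _ u])
  have "(q \<longlongrightarrow> D) (at_left t)"
  proof (rule order_tendstoI)
    fix e assume "e < D"
    show "\<forall>\<^sub>F s in at_left t. e < q s"
      using near[OF aJ] by eventually_elim (use D_le \<open>e < D\<close> in force)
  next
    fix e assume "D < e"
    then obtain u where u: "u \<in> J" "q u < e"
      unfolding D_def using cINF_less_iff[OF _ bdd] aJ by blast
    show "\<forall>\<^sub>F s in at_left t. q s < e"
      using near[OF u(1)]
    proof eventually_elim
      case (elim s)
      then show ?case using q_anti[of u s] u by (auto simp: J_def)
    qed
  qed
  moreover have "(\<phi> s - \<phi> t) / (s - t) = q s" for s
    unfolding q_def by (metis minus_diff_eq minus_divide_divide)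
  ultimately have der: "(\<phi> has_real_derivative D) (at_left t)"
    by (simp add: has_field_derivative_iff)
  have left: "left_deriv \<phi> t = D"
    unfolding left_deriv_def
  proof (rule the_equality, rule der)
    fix D' assume D': "(\<phi> has_real_derivative D') (at_left t)"
    show "D' = D"
      using der D' unfolding has_field_derivative_iff by (rule tendsto_unique[OF trivial_limit_at_left_real, rotated])
  qed
  show ?thesis
    using D_le[of s] left s by (cases "s = t") (auto simp: J_def q_def field_simps)
qed

section \<open>Gradients, partial gradients and the descent lemma\<close>

lemma gderiv_grad_eq:
  assumes "GDERIV h x :> D"
  shows "grad h x = D"
  unfolding grad_def
proof (rule the_equality, rule assms)
  fix D' assume "GDERIV h x :> D'"
  with assms have "(\<lambda>h. h \<bullet> D') = (\<lambda>h. h \<bullet> D)"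
    unfolding gderiv_def using has_derivative_unique by blast
  then show "D' = D"
    by (metis vector_eq_ldot)
qed

lemma C1_fun_gderiv:
  fixes F :: "'a::euclidean_space \<Rightarrow> real"
  assumes "C1_fun F"
  shows "GDERIV F z :> grad F z"
proof -
  obtain F' where F': "(F has_derivative F') (at z)"
    using assms by (auto simp: C1_fun_def differentiable_def)
  then have lin: "linear F'"
    by (rule has_derivative_linear)
  have "F' h = h \<bullet> (\<Sum>b\<in>Basis. F' b *\<^sub>R b)" for h
  proof -
    have "F' h = F' (\<Sum>b\<in>Basis. (h \<bullet> b) *\<^sub>R b)"
      by (simp add: euclidean_representation)
    also have "\<dots> = (\<Sum>b\<in>Basis. (h \<bullet> b) * F' b)"
      using lin by (simp add: linear_sum linear_scale)
    finally show ?thesis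
      by (simp add: inner_sum_right mult.commute)
  qed
  then have ex: "GDERIV F z :> (\<Sum>b\<in>Basis. F' b *\<^sub>R b)"
    unfolding gderiv_def by (intro has_derivative_eq_rhs[OF F'] ext)
  then have "grad F z = (\<Sum>b\<in>Basis. F' b *\<^sub>R b)"
    by (rule gderiv_grad_eq)
  with ex show ?thesis by simp
qed

lemma grad_x_eq_fst_grad:
  fixes F :: "'a::euclidean_space \<times> 'b::euclidean_space \<Rightarrow> real"
  assumes "C1_fun F"
  shows "GDERIV (\<lambda>u. F (u, v)) u :> grad_x F u v" and "grad_x F u v = fst (grad F (u, v))"
proof -
  have d: "(F has_derivative (\<lambda>h. h \<bullet> grad F (u, v))) (at (u, v))"
    using C1_fun_gderiv[OF assms] by (simp add: gderiv_def)
  have "((\<lambda>u. F (u, v)) has_derivative (\<lambda>h. (h, 0) \<bullet> grad F (u, v))) (at u)"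
    by (rule has_derivative_compose[where f = "\<lambda>u. (u, v)" and g = F, OF _ d]) (auto intro!: derivative_eq_intros)
  then have "GDERIV (\<lambda>u. F (u, v)) u :> fst (grad F (u, v))"
    by (simp add: gderiv_def inner_prod_def)
  moreover from this show "grad_x F u v = fst (grad F (u, v))"
    unfolding grad_x_def by (rule gderiv_grad_eq)
  ultimately show "GDERIV (\<lambda>u. F (u, v)) u :> grad_x F u v"
    by simp
qed

lemma grad_y_eq_snd_grad:
  fixes F :: "'a::euclidean_space \<times> 'b::euclidean_space \<Rightarrow> real"
  assumes "C1_fun F"
  shows "GDERIV (\<lambda>v. F (u, v)) v :> grad_y F u v" and "grad_y F u v = snd (grad F (u, v))"
proof -
  have d: "(F has_derivative (\<lambda>h. h \<bullet> grad F (u, v))) (at (u, v))"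
    using C1_fun_gderiv[OF assms] by (simp add: gderiv_def)
  have "((\<lambda>v. F (u, v)) has_derivative (\<lambda>h. (0, h) \<bullet> grad F (u, v))) (at v)"
    by (rule has_derivative_compose[where f = "\<lambda>v. (u, v)" and g = F, OF _ d]) (auto intro!: derivative_eq_intros)
  then have "GDERIV (\<lambda>v. F (u, v)) v :> snd (grad F (u, v))"
    by (simp add: gderiv_def inner_prod_def)
  moreover from this show "grad_y F u v = snd (grad F (u, v))"
    unfolding grad_y_def by (rule gderiv_grad_eq)
  ultimately show "GDERIV (\<lambda>v. F (u, v)) v :> grad_y F u v"
    by simp
qed

text \<open>Along the segment from \<open>x\<close> to \<open>p\<close> the gap between \<open>h\<close> and the quadratic model has a
  nonpositive derivative, because the gradient has moved by at most \<open>t L \<parallel>p - x\<parallel>\<close> at time \<open>t\<close>.\<close>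

lemma lipschitz_gradient_upper_bound:
  fixes h :: "'a::real_inner \<Rightarrow> real"
  assumes der: "\<And>u. GDERIV h u :> G u" and lip: "L-lipschitz_on UNIV G"
  shows "h p \<le> h x + G x \<bullet> (p - x) + L / 2 * (norm (p - x))\<^sup>2"
proof -
  define e where "e = p - x"
  define \<theta> where "\<theta> t = h (x + t *\<^sub>R e) - t * (G x \<bullet> e) - L / 2 * t\<^sup>2 * (norm e)\<^sup>2" for t
  have "\<theta> 1 \<le> \<theta> 0"
  proof (rule DERIV_nonpos_imp_nonincreasing[where f = \<theta>])
    fix t :: real assume t: "0 \<le> t" "t \<le> 1"
    have "((\<lambda>t. h (x + t *\<^sub>R e)) has_derivative (\<lambda>s. (s *\<^sub>R e) \<bullet> G (x + t *\<^sub>R e))) (at t)"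
      by (rule has_derivative_compose[where g = h, OF _ der[unfolded gderiv_def]])
        (auto intro!: derivative_eq_intros)
    then have "((\<lambda>t. h (x + t *\<^sub>R e)) has_real_derivative e \<bullet> G (x + t *\<^sub>R e)) (at t)"
      by (simp add: has_field_derivative_def mult.commute[of _ "e \<bullet> G (x + t *\<^sub>R e)"])
    then have "(\<theta> has_real_derivative e \<bullet> G (x + t *\<^sub>R e) - G x \<bullet> e - L * t * (norm e)\<^sup>2) (at t)"
      unfolding \<theta>_def by (auto intro!: derivative_eq_intros)
    moreover have "e \<bullet> G (x + t *\<^sub>R e) - G x \<bullet> e \<le> L * t * (norm e)\<^sup>2"
    proof -
      have "e \<bullet> G (x + t *\<^sub>R e) - G x \<bullet> e = e \<bullet> (G (x + t *\<^sub>R e) - G x)"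
        by (simp add: inner_diff_right inner_commute)
      also have "\<dots> \<le> norm e * norm (G (x + t *\<^sub>R e) - G x)"
        by (rule norm_cauchy_schwarz)
      also have "\<dots> \<le> norm e * (L * norm (t *\<^sub>R e))"
        using lipschitz_onD[OF lip, of "x + t *\<^sub>R e" x]
        by (intro mult_left_mono) (auto simp: dist_norm)
      finally show ?thesis
        using t by (simp add: power2_eq_square algebra_simps)
    qed
    ultimately show "\<exists>y. (\<theta> has_real_derivative y) (at t) \<and> y \<le> 0"
      by (intro exI conjI) auto
  qed simp
  then show ?thesis
    by (simp add: \<theta>_def e_def)
qed

section \<open>Proximal gradient steps\<close>

text \<open>Expanding the square in the optimality of \<open>p\<close> around \<open>p\<close> itself turns it into a global quadratic
  minorant of \<open>f\<close> that touches \<open>f\<close> at \<open>p\<close>. Everything that the convergence analysis needs from a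
  proximal step can be read off from this inequality: decrease (take \<open>u = x\<close>), a subgradient at \<open>p\<close>
  (let \<open>u\<close> tend to \<open>p\<close>), and upper bounds on \<open>f p\<close> in terms of the value at a limit point
  (take \<open>u\<close> to be that point).\<close>

lemma prox_minorant:
  fixes f :: "'a::real_inner \<Rightarrow> ereal"
  assumes "proper f" and "c > 0" and p: "p \<in> prox f c (x - (1 / c) *\<^sub>R G)"
  shows "\<bar>f p\<bar> \<noteq> \<infinity>"
    and "f p + ereal ((c *\<^sub>R (x - p) - G) \<bullet> (u - p) - c / 2 * (norm (u - p))\<^sup>2) \<le> f u"
proof -
  define w where "w = x - (1 / c) *\<^sub>R G"
  have opt: "f p + ereal (c / 2 * (norm (w - p))\<^sup>2) \<le> f u + ereal (c / 2 * (norm (w - u))\<^sup>2)" for u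
    using p by (auto simp: prox_def is_arg_min_def w_def not_less)
  obtain u0 where "f u0 \<noteq> \<infinity>"
    using \<open>proper f\<close> by (auto simp: proper_def)
  then have "f p \<noteq> \<infinity>"
    using opt[of u0] by (cases "f u0") auto
  then show fin: "\<bar>f p\<bar> \<noteq> \<infinity>"
    using \<open>proper f\<close> by (auto simp: proper_def)
  have expand: "(norm (w - u))\<^sup>2 = (norm (w - p))\<^sup>2 - 2 * ((w - p) \<bullet> (u - p)) + (norm (u - p))\<^sup>2"
    unfolding power2_norm_eq_inner by (simp add: algebra_simps inner_commute)
  have "c / 2 * (norm (w - p))\<^sup>2 - c / 2 * (norm (w - u))\<^sup>2
      = (c *\<^sub>R (w - p)) \<bullet> (u - p) - c / 2 * (norm (u - p))\<^sup>2"
    unfolding expand by (simp add: algebra_simps)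
  moreover have "c *\<^sub>R (w - p) = c *\<^sub>R (x - p) - G"
    using \<open>c > 0\<close> by (simp add: w_def algebra_simps)
  ultimately show "f p + ereal ((c *\<^sub>R (x - p) - G) \<bullet> (u - p) - c / 2 * (norm (u - p))\<^sup>2) \<le> f u"
    using opt[of u] fin by (cases "f p"; cases "f u") auto
qed

text \<open>The minorant at \<open>u = x\<close> shows that \<open>f\<close> plus the linearisation of \<open>h\<close> at \<open>x\<close> decreases by \<open>c / 2\<close> times
  the squared step length; replacing the linearisation by \<open>h\<close> costs at most \<open>L / 2\<close> times it. A step
  parameter \<open>c > L\<close> leaves a net gain.\<close>

lemma prox_gradient_descent:
  fixes f :: "'a::real_inner \<Rightarrow> ereal"
  assumes "proper f" "c > 0" "p \<in> prox f c (x - (1 / c) *\<^sub>R G x)"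
    and "\<And>u. GDERIV h u :> G u" "L-lipschitz_on UNIV G"
  shows "f p + ereal (h p) + ereal ((c - L) / 2 * (norm (p - x))\<^sup>2) \<le> f x + ereal (h x)"
proof -
  have "(c *\<^sub>R (x - p) - G x) \<bullet> (x - p) - c / 2 * (norm (x - p))\<^sup>2
      = c / 2 * (norm (p - x))\<^sup>2 + G x \<bullet> (p - x)"
    unfolding power2_norm_eq_inner by (simp add: algebra_simps inner_commute)
  then have "f p + ereal (c / 2 * (norm (p - x))\<^sup>2 + G x \<bullet> (p - x)) \<le> f x"
    using prox_minorant(2)[OF assms(1-3), of x] by simp
  moreover have "h p \<le> h x + G x \<bullet> (p - x) + L / 2 * (norm (p - x))\<^sup>2"
    by (rule lipschitz_gradient_upper_bound[OF assms(4,5)])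
  moreover have "\<bar>f p\<bar> \<noteq> \<infinity>"
    by (rule prox_minorant(1)[OF assms(1-3)])
  ultimately show ?thesis
    by (cases "f p"; cases "f x") (auto simp: field_simps)
qed

section \<open>Quadratic minorants up to a smooth summand\<close>

text \<open>For \<open>\<Psi> = \<psi> + F\<close> with \<open>F\<close> smooth this says that \<open>q - \<nabla>F z\<close> is a proximal subgradient of \<open>\<psi>\<close> at \<open>z\<close>
  with constant \<open>c\<close>, valid globally. It is stated for \<open>\<Psi>\<close> itself, so that \<open>F\<close> enters through its
  first-order Taylor remainder at \<open>z\<close>.\<close>

definition quad_minorant ::
  "('a::real_inner \<Rightarrow> ereal) \<Rightarrow> ('a \<Rightarrow> real) \<Rightarrow> real \<Rightarrow> 'a \<Rightarrow> 'a \<Rightarrow> bool" where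
  "quad_minorant \<Psi> F c q z \<longleftrightarrow> \<bar>\<Psi> z\<bar> \<noteq> \<infinity> \<and>
     (\<forall>w. \<Psi> z + ereal (q \<bullet> (w - z) - c / 2 * (norm (w - z))\<^sup>2
             + (F w - F z - grad F z \<bullet> (w - z))) \<le> \<Psi> w)"

lemma quad_minorant_imp_regular_subdiff:
  fixes \<Psi> :: "'a::euclidean_space \<Rightarrow> ereal"
  assumes "C1_fun F" and min: "quad_minorant \<Psi> F c q z"
  shows "q \<in> regular_subdiff \<Psi> z"
proof -
  define r where "r w = F w - F z - grad F z \<bullet> (w - z) - c / 2 * (norm (w - z))\<^sup>2" for w
  have "((\<lambda>w. (F w - F z - grad F z \<bullet> (w - z)) / norm (w - z)) \<longlongrightarrow> 0) (at z)"
    using C1_fun_gderiv[OF assms(1), of z]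
    by (simp add: gderiv_def has_derivative_at_within inner_commute divide_inverse mult.commute)
  moreover have "((\<lambda>w. c / 2 * norm (w - z)) \<longlongrightarrow> 0) (at z)"
    by (auto intro!: tendsto_eq_intros)
  ultimately have "((\<lambda>w. (F w - F z - grad F z \<bullet> (w - z)) / norm (w - z) - c / 2 * norm (w - z))
      \<longlongrightarrow> 0) (at z)"
    using tendsto_diff by fastforce
  moreover have "(F w - F z - grad F z \<bullet> (w - z)) / norm (w - z) - c / 2 * norm (w - z)
      = r w / norm (w - z)" for w
    by (simp add: r_def diff_divide_distrib power2_eq_square)
  ultimately have "r \<in> o[at z](\<lambda>w. norm (w - z))"
    by (intro smalloI_tendsto) (auto simp: eventually_at_filter)
  moreover have "\<Psi> z + ereal (q \<bullet> (w - z) + r w) \<le> \<Psi> w" for w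
    using min by (simp add: quad_minorant_def r_def algebra_simps)
  ultimately show ?thesis
    using min by (auto simp: regular_subdiff_def quad_minorant_def intro!: exI[of _ r])
qed

text \<open>A lower semicontinuous \<open>\<Psi>\<close> need not be continuous along a convergent sequence. Evaluating the
  minorants at the limit point \<open>w\<close> bounds \<open>\<Psi> (z j)\<close> by \<open>\<Psi> w\<close> up to an error that vanishes as long
  as the subgradients \<open>q j\<close> stay bounded, which supplies the missing upper estimate.\<close>

lemma quad_minorant_Limsup_le:
  fixes \<Psi> :: "'a::euclidean_space \<Rightarrow> ereal"
  assumes F: "C1_fun F" and min: "\<And>j. quad_minorant \<Psi> F c (q j) (z j)"
    and q: "bounded (range q)" and z: "z \<longlonglongrightarrow> w"
  shows "limsup (\<lambda>j. \<Psi> (z j)) \<le> \<Psi> w"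
proof -
  define e where "e j = q j \<bullet> (w - z j) - c / 2 * (norm (w - z j))\<^sup>2
    + (F w - F (z j) - grad F (z j) \<bullet> (w - z j))" for j
  have wz: "(\<lambda>j. w - z j) \<longlonglongrightarrow> 0"
    using tendsto_diff[OF tendsto_const[of w] z] by simp
  obtain B where B: "\<And>j. norm (q j) \<le> B"
    using q by (auto simp: bounded_iff)
  have "(\<lambda>j. q j \<bullet> (w - z j)) \<longlonglongrightarrow> 0"
  proof (rule Lim_null_comparison)
    show "\<forall>\<^sub>F j in sequentially. norm (q j \<bullet> (w - z j)) \<le> B * norm (w - z j)"
    proof (rule always_eventually, rule allI)
      fix j
      have "norm (q j \<bullet> (w - z j)) \<le> norm (q j) * norm (w - z j)"
        using Cauchy_Schwarz_ineq2 by simp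
      also have "\<dots> \<le> B * norm (w - z j)"
        using B by (simp add: mult_right_mono)
      finally show "norm (q j \<bullet> (w - z j)) \<le> B * norm (w - z j)" .
    qed
    show "(\<lambda>j. B * norm (w - z j)) \<longlonglongrightarrow> 0"
      using tendsto_mult_left[OF tendsto_norm[OF wz], of B] by simp
  qed
  moreover have "(\<lambda>j. F (z j)) \<longlonglongrightarrow> F w"
    using F z by (auto simp: C1_fun_def dest: differentiable_imp_continuous_within
        intro: isCont_tendsto_compose)
  moreover have "(\<lambda>j. grad F (z j)) \<longlonglongrightarrow> grad F w"
    using F z by (auto simp: C1_fun_def continuous_on_eq_continuous_at intro: isCont_tendsto_compose)
  ultimately have "e \<longlonglongrightarrow> 0 - c / 2 * (norm (0::'a))\<^sup>2 + (F w - F w - grad F w \<bullet> 0)"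
    unfolding e_def using wz by (intro tendsto_intros)
  then have "(\<lambda>j. ereal (- e j)) \<longlonglongrightarrow> ereal (- 0)"
    by (intro tendsto_intros) auto
  then have lim: "(\<lambda>j. \<Psi> w + ereal (- e j)) \<longlonglongrightarrow> \<Psi> w"
    using tendsto_add_ereal_general[of "\<Psi> w" 0 "\<lambda>j. \<Psi> w" sequentially "\<lambda>j. ereal (- e j)"]
    by (simp add: zero_ereal_def)
  have "\<Psi> (z j) \<le> \<Psi> w + ereal (- e j)" for j
  proof -
    have "\<Psi> (z j) + ereal (e j) \<le> \<Psi> w" "\<bar>\<Psi> (z j)\<bar> \<noteq> \<infinity>"
      using min[of j] by (auto simp: quad_minorant_def e_def)
    then show ?thesis
      by (cases "\<Psi> (z j)"; cases "\<Psi> w") auto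
  qed
  then have "limsup (\<lambda>j. \<Psi> (z j)) \<le> limsup (\<lambda>j. \<Psi> w + ereal (- e j))"
    by (intro Limsup_mono) auto
  also have "\<dots> = \<Psi> w"
    by (rule lim_imp_Limsup[OF _ lim]) simp
  finally show ?thesis .
qed

section \<open>Descent sequences and the Kurdyka-Lojasiewicz inequality\<close>

lemma regular_subset_limiting_subdiff: "regular_subdiff \<Psi> x \<subseteq> limiting_subdiff \<Psi> x"
proof
  fix v assume v: "v \<in> regular_subdiff \<Psi> x"
  then show "v \<in> limiting_subdiff \<Psi> x"
    unfolding limiting_subdiff_def
    by (intro CollectI conjI exI[of _ "\<lambda>_. x"] exI[of _ "\<lambda>_. v"])
      (auto simp: regular_subdiff_def)
qed

text \<open>Lower semicontinuity is stated with punctured neighbourhoods; terms of the sequence that equal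
  the limit satisfy the bound trivially.\<close>

lemma lsc_eventually_above:
  assumes "lsc \<Psi>" and "a < \<Psi> w" and "zs \<longlonglongrightarrow> w"
  shows "\<forall>\<^sub>F j in sequentially. a < \<Psi> (zs j)"
proof -
  have "\<forall>\<^sub>F x in at w. a < \<Psi> x"
    using assms(1,2) by (intro less_LiminfD) (auto simp: lsc_def intro: less_le_trans)
  then have "\<forall>\<^sub>F x in nhds w. a < \<Psi> x"
    using assms(2) by (auto simp: eventually_nhds_conv_at)
  then show ?thesis
    using assms(3) by (auto simp: filterlim_iff)
qed

text \<open>The key estimate. Here \<open>t\<close> and \<open>t'\<close> are consecutive gaps to the limit value, \<open>d\<^sub>0\<close> and \<open>d\<close> the
  lengths of the steps before and after, and \<open>b * d\<^sub>0\<close> bounds a subgradient. Concavity turns the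
  decrease \<open>\<rho> / 2 * d\<^sup>2\<close> of the function values into a decrease of at least
  \<open>left_deriv \<phi> t * (\<rho> / 2 * d\<^sup>2)\<close> of \<open>\<phi>\<close>, and the Kurdyka-Lojasiewicz inequality bounds the
  derivative from below by the reciprocal of \<open>b * d\<^sub>0\<close>. So \<open>d\<^sup>2\<close> is at most a product of \<open>d\<^sub>0\<close> and a
  multiple of the decrease of \<open>\<phi>\<close>, and the arithmetic-geometric mean inequality separates the two
  factors.\<close>

lemma KL_step_estimate:
  assumes conc: "concave_on (dom_upto \<eta>) \<phi>"
    and t: "0 \<le> t'" "0 < t" "ereal t < \<eta>"
    and descent: "t' + \<rho> / 2 * d\<^sup>2 \<le> t" "0 < \<rho>"
    and KL: "1 \<le> left_deriv \<phi> t * (b * d\<^sub>0)"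
    and nonneg: "0 \<le> b" "0 \<le> d\<^sub>0"
  shows "2 * d \<le> 2 * b / \<rho> * (\<phi> t - \<phi> t') + d\<^sub>0"
proof -
  define E where "E = 2 * b / \<rho> * (\<phi> t - \<phi> t')"
  define D where "D = left_deriv \<phi> t"
  have "0 < D"
  proof (rule ccontr)
    assume "\<not> 0 < D"
    then have "D * (b * d\<^sub>0) \<le> 0"
      using nonneg by (simp add: mult_nonpos_nonneg)
    with KL show False
      by (simp add: D_def)
  qed
  have "0 \<le> \<rho> / 2 * d\<^sup>2"
    using \<open>0 < \<rho>\<close> by simp
  then have "t' \<le> t"
    using descent(1) by linarith
  then have t'_dom: "t' \<in> dom_upto \<eta>"
    using t le_less_trans[of "ereal t'" "ereal t" \<eta>] by (simp add: dom_upto_def)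
  obtain u where "ereal t < ereal u" "ereal u < \<eta>"
    using ereal_dense2[OF t(3)] by blast
  then have u: "u \<in> dom_upto \<eta>" "t < u"
    using t by (auto simp: dom_upto_def)
  have "0 \<in> dom_upto \<eta>"
    using t less_trans[of "ereal 0" "ereal t" \<eta>] by (simp add: dom_upto_def zero_ereal_def)
  then have slope: "D * (t - t') \<le> \<phi> t - \<phi> t'"
    unfolding D_def using concave_left_deriv[OF conc _ \<open>0 < t\<close> u t'_dom \<open>t' \<le> t\<close>] by simp
  have "\<rho> / 2 * d\<^sup>2 \<le> (D * (b * d\<^sub>0)) * (\<rho> / 2 * d\<^sup>2)"
    using KL mult_right_mono[of 1 "D * (b * d\<^sub>0)" "\<rho> / 2 * d\<^sup>2"] \<open>0 < \<rho>\<close> by (simp add: D_def)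
  also have "\<dots> = (b * d\<^sub>0) * (D * (\<rho> / 2 * d\<^sup>2))"
    by simp
  also have "\<dots> \<le> (b * d\<^sub>0) * (D * (t - t'))"
    using descent nonneg \<open>0 < D\<close> by (intro mult_left_mono) auto
  also have "\<dots> \<le> (b * d\<^sub>0) * (\<phi> t - \<phi> t')"
    using slope nonneg by (intro mult_left_mono) auto
  finally have "d\<^sup>2 \<le> E * d\<^sub>0"
    using \<open>0 < \<rho>\<close> by (simp add: E_def field_simps)
  moreover have "0 \<le> E"
  proof -
    have "0 \<le> D * (t - t')"
      using \<open>0 < D\<close> \<open>t' \<le> t\<close> by simp
    then show ?thesis
      using slope nonneg \<open>0 < \<rho>\<close> by (simp add: E_def)
  qed
  moreover have "4 * (E * d\<^sub>0) \<le> (E + d\<^sub>0)\<^sup>2"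
    using zero_le_power2[of "E - d\<^sub>0"] by (simp add: power2_eq_square algebra_simps)
  ultimately have "(2 * d)\<^sup>2 \<le> (E + d\<^sub>0)\<^sup>2"
    by (simp add: power_mult_distrib)
  then have "2 * d \<le> E + d\<^sub>0"
    by (rule power2_le_imp_le) (use \<open>0 \<le> E\<close> nonneg in auto)
  then show ?thesis
    by (simp add: E_def)
qed

text \<open>Of the two copies of \<open>d k\<close> one is kept for the length and the other cancels against the
  \<open>d (k - 1)\<close> of the following step, so that only boundary terms survive.\<close>

lemma telescoped_length_bound:
  fixes d s :: "nat \<Rightarrow> real"
  assumes step: "\<And>k. p \<le> k \<Longrightarrow> k < n \<Longrightarrow> 2 * d k \<le> s k - s (Suc k) + d (k - 1)"
    and "p \<le> n"
  shows "(\<Sum>k=p..<n. d k) \<le> s p - s n + d (p - 1) - d (n - 1)"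
  using \<open>p \<le> n\<close> step
proof (induction n rule: dec_induct)
  case (step n)
  from step.hyps step.prems have "2 * d n \<le> s n - s (Suc n) + d (n - 1)"
    by simp
  moreover have "(\<Sum>k=p..<n. d k) \<le> s p - s n + d (p - 1) - d (n - 1)"
    using step.IH step.prems by simp
  ultimately show ?case
    using step.hyps by (simp add: sum.atLeastLessThan_Suc)
qed simp

lemma dist_le_sum_increments:
  fixes z :: "nat \<Rightarrow> 'a::real_normed_vector"
  assumes "m \<le> n"
  shows "dist (z n) (z m) \<le> (\<Sum>k=m..<n. norm (z (Suc k) - z k))"
  using norm_sum[of "\<lambda>k. z (Suc k) - z k" "{m..<n}"] sum_Suc_diff'[OF assms, of z]
  by (simp add: dist_norm)

text \<open>The convergence principle for descent methods, with sufficient decrease (\<open>descent\<close>), a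
  subgradient controlled by the last step (\<open>error\<close>) and upper semicontinuity of \<open>\<Psi>\<close> along
  convergent subsequences (\<open>cont\<close>) as its ingredients. The values decrease to \<open>\<Psi> w\<close> for any
  cluster point \<open>w\<close>, and \<open>w\<close> is stationary, so the Kurdyka-Lojasiewicz inequality is available near
  \<open>w\<close>. Its range of validity is a neighbourhood of this single point. The sequence stays there:
  once it is close enough to \<open>w\<close>, with a small gap and a small last step, the length bound shows
  that it cannot travel far enough to leave, which in turn keeps the length bound valid. The index
  shifts accommodate an initial point \<open>z 0\<close> at which \<open>\<Psi>\<close> may be infinite: decrease starts at
  \<open>z 1\<close> and subgradient control at \<open>z 2\<close>.\<close>

theorem KL_descent_sequence_converges:
  fixes \<Psi> :: "'a::euclidean_space \<Rightarrow> ereal" and z :: "nat \<Rightarrow> 'a"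
  assumes KL: "gen_concave_KL \<Psi>" and \<rho>: "0 < \<rho>" and b: "0 \<le> b" and bdd: "bounded (range z)"
    and fin: "\<And>k. k \<ge> 1 \<Longrightarrow> \<bar>\<Psi> (z k)\<bar> \<noteq> \<infinity>"
    and descent: "\<And>k. k \<ge> 1 \<Longrightarrow>
      \<Psi> (z (Suc k)) + ereal (\<rho> / 2 * (norm (z (Suc k) - z k))\<^sup>2) \<le> \<Psi> (z k)"
    and error: "\<And>k. k \<ge> 1 \<Longrightarrow>
      \<exists>q\<in>regular_subdiff \<Psi> (z (Suc k)). norm q \<le> b * norm (z (Suc k) - z k)"
    and cont: "\<And>s w. strict_mono s \<Longrightarrow> (\<And>j. 2 \<le> s j) \<Longrightarrow> (\<lambda>j. z (s j)) \<longlonglongrightarrow> w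
      \<Longrightarrow> limsup (\<lambda>j. \<Psi> (z (s j))) \<le> \<Psi> w"
    and C: "C = 2 * b / \<rho>"
  obtains w and l :: nat and \<eta> \<phi> where "z \<longlonglongrightarrow> w" "0 \<in> limiting_subdiff \<Psi> w"
    "l \<ge> 1" "0 < \<eta>" "\<phi> \<in> Phi \<eta>"
    "\<And>p. p \<ge> l + 1 \<Longrightarrow> 0 \<le> \<Psi> (z p) - \<Psi> w"
    "\<And>p. p \<ge> l + 1 \<Longrightarrow> \<Psi> (z p) - \<Psi> w < \<eta>"
    "\<And>p n. p \<ge> l + 1 \<Longrightarrow> p \<le> n \<Longrightarrow> (\<Sum>k=p..<n. norm (z (Suc k) - z k))
       \<le> C * \<phi> (real_of_ereal (\<Psi> (z p) - \<Psi> w)) + norm (z p - z (p - 1))"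
proof -
  define \<psi> where "\<psi> k = real_of_ereal (\<Psi> (z k))" for k
  define d where "d k = norm (z (Suc k) - z k)" for k
  have \<psi>: "\<Psi> (z k) = ereal (\<psi> k)" if "k \<ge> 1" for k
    using fin[OF that] by (simp add: \<psi>_def ereal_real)
  have dec: "\<psi> (Suc k) + \<rho> / 2 * (d k)\<^sup>2 \<le> \<psi> k" if "k \<ge> 1" for k
    using descent[OF that] that by (simp add: \<psi> d_def)
  have mono: "\<psi> n \<le> \<psi> m" if "1 \<le> m" "m \<le> n" for m n
    using that(2)
  proof (induction n rule: dec_induct)
    case (step n)
    have "0 \<le> \<rho> / 2 * (d n)\<^sup>2"
      using \<rho> by simp
    then have "\<psi> (Suc n) \<le> \<psi> n"
      using dec[of n] step.hyps that(1) by linarith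
    with step show ?case by simp
  qed simp

  \<comment> \<open>Choosing the cluster point for the sequence from index 2 on makes every selected iterate
    the endpoint of a step that starts at index at least 1.\<close>
  have "bounded (range (\<lambda>k. z (k + 2)))"
    using bdd by (rule bounded_subset) auto
  then obtain w r where r: "strict_mono r" "((\<lambda>k. z (k + 2)) \<circ> r) \<longlonglongrightarrow> w"
    using bounded_imp_convergent_subsequence by blast
  define s where "s j = r j + 2" for j
  have s: "strict_mono s" and s2: "2 \<le> s j" and zs: "(\<lambda>j. z (s j)) \<longlonglongrightarrow> w" for j
    using r by (auto simp: s_def strict_mono_def o_def)
  have s_ge: "j \<le> s j" for j
    using seq_suble[OF s] .

  have "lsc \<Psi>" "proper \<Psi>"
    using KL by (auto simp: gen_concave_KL_def)
  have below: "\<Psi> w \<le> \<Psi> (z k)" if "k \<ge> 1" for k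
  proof (rule ccontr)
    assume "\<not> ?thesis"
    then have "\<forall>\<^sub>F j in sequentially. \<Psi> (z k) < \<Psi> (z (s j)) \<and> k \<le> j"
      using lsc_eventually_above[OF \<open>lsc \<Psi>\<close> _ zs]
      by (intro eventually_conj eventually_ge_at_top) auto
    then obtain j where "\<Psi> (z k) < \<Psi> (z (s j))" "k \<le> j"
      by (auto simp: eventually_sequentially)
    then show False
      using mono[OF that, of "s j"] s_ge[of j] s2[of j] that by (simp add: \<psi>)
  qed
  define \<zeta> where "\<zeta> = real_of_ereal (\<Psi> w)"
  have \<zeta>: "\<Psi> w = ereal \<zeta>"
    using below[of 1] fin[of 1] \<open>proper \<Psi>\<close>
    by (cases "\<Psi> w") (auto simp: \<zeta>_def proper_def)
  define t where "t k = \<psi> k - \<zeta>" for k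
  have t_nonneg: "0 \<le> t k" if "k \<ge> 1" for k
    using below[OF that] that by (simp add: \<psi> \<zeta> t_def)
  have t_eq: "\<Psi> (z k) - \<Psi> w = ereal (t k)" if "k \<ge> 1" for k
    using that by (simp add: \<psi> \<zeta> t_def)
  have t_lim: "t \<longlonglongrightarrow> 0"
  proof (rule order_tendstoI)
    fix a :: real assume "a < 0"
    then show "\<forall>\<^sub>F k in sequentially. a < t k"
      using t_nonneg by (intro eventually_sequentiallyI[of 1]) force
  next
    fix a :: real assume "0 < a"
    then have "\<forall>\<^sub>F j in sequentially. \<Psi> (z (s j)) < ereal (\<zeta> + a)"
      using cont[OF s s2 zs] by (intro Limsup_lessD) (auto simp: \<zeta> intro: le_less_trans)
    then obtain j where "\<Psi> (z (s j)) < ereal (\<zeta> + a)"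
      by (auto simp: eventually_sequentially)
    then have "t (s j) < a"
      using s2[of j] by (simp add: \<psi> t_def)
    then show "\<forall>\<^sub>F k in sequentially. t k < a"
      using mono[of "s j"] s2[of j] by (intro eventually_sequentiallyI[of "s j"]) (force simp: t_def)
  qed
  have d_lim: "d \<longlonglongrightarrow> 0"
  proof -
    have "(\<lambda>k. 2 / \<rho> * (t k - t (Suc k))) \<longlonglongrightarrow> 2 / \<rho> * (0 - 0)"
      by (intro tendsto_intros t_lim LIMSEQ_Suc)
    then have lim: "(\<lambda>k. 2 / \<rho> * (t k - t (Suc k))) \<longlonglongrightarrow> 0"
      by simp
    have "(\<lambda>k. (d k)\<^sup>2) \<longlonglongrightarrow> 0"
    proof (rule Lim_null_comparison[OF _ lim])
      show "\<forall>\<^sub>F k in sequentially. norm ((d k)\<^sup>2) \<le> 2 / \<rho> * (t k - t (Suc k))"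
        using dec \<rho> by (intro eventually_sequentiallyI[of 1]) (simp add: t_def field_simps)
    qed
    then show ?thesis
      by simp
  qed

  obtain q where q: "\<And>k. k \<ge> 1 \<Longrightarrow> q k \<in> regular_subdiff \<Psi> (z (Suc k))"
      "\<And>k. k \<ge> 1 \<Longrightarrow> norm (q k) \<le> b * d k"
    using error unfolding d_def by metis
  have stationary: "0 \<in> limiting_subdiff \<Psi> w"
  proof -
    have pred: "Suc (s j - 1) = s j" "1 \<le> s j - 1" for j
      using s2[of j] by auto
    have "(\<lambda>j. \<Psi> (z (s j))) \<longlonglongrightarrow> \<Psi> w"
    proof -
      have "(\<lambda>j. t (s j) + \<zeta>) \<longlonglongrightarrow> 0 + \<zeta>"
        using LIMSEQ_subseq_LIMSEQ[OF t_lim s] by (intro tendsto_intros) (simp add: o_def)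
      then have "(\<lambda>j. ereal (t (s j) + \<zeta>)) \<longlonglongrightarrow> ereal \<zeta>"
        by simp
      moreover have "ereal (t (s j) + \<zeta>) = \<Psi> (z (s j))" for j
        using s2[of j] by (simp add: \<psi> t_def)
      ultimately show ?thesis
        by (simp add: \<zeta>)
    qed
    moreover have "(\<lambda>j. q (s j - 1)) \<longlonglongrightarrow> 0"
    proof (rule Lim_null_comparison)
      show "\<forall>\<^sub>F j in sequentially. norm (q (s j - 1)) \<le> b * d (s j - 1)"
        using q(2)[OF pred(2)] by simp
      have "strict_mono (\<lambda>j. s j - 1)"
      proof (rule strict_monoI)
        fix i j :: nat assume "i < j"
        then have "s i < s j"
          by (rule strict_monoD[OF s])
        with s2[of i] show "s i - 1 < s j - 1"
          by linarith
      qed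
      then show "(\<lambda>j. b * d (s j - 1)) \<longlonglongrightarrow> 0"
        using LIMSEQ_subseq_LIMSEQ[OF d_lim] by (auto simp: o_def intro!: tendsto_mult_right_zero)
    qed
    moreover have "q (s j - 1) \<in> regular_subdiff \<Psi> (z (s j))" for j
      using q(1)[OF pred(2)[of j]] pred(1)[of j] by simp
    ultimately show ?thesis
      using zs unfolding limiting_subdiff_def
      by (intro CollectI conjI exI[of _ "\<lambda>j. z (s j)"] exI[of _ "\<lambda>j. q (s j - 1)"])
        (auto simp: \<zeta>)
  qed

  then have "gen_concave_KL_at \<Psi> w"
    using KL by (auto simp: gen_concave_KL_def)
  then obtain U \<eta> \<phi> where U: "open U" "w \<in> U" and \<eta>: "0 < \<eta>" and \<phi>: "\<phi> \<in> Phi \<eta>"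
      and conc: "concave_on (dom_upto \<eta>) \<phi>"
      and KLw: "\<And>x. x \<in> U \<Longrightarrow> 0 < \<Psi> x - \<Psi> w \<Longrightarrow> \<Psi> x - \<Psi> w < \<eta> \<Longrightarrow>
        1 \<le> ereal (left_deriv \<phi> (real_of_ereal (\<Psi> x - \<Psi> w))) * edist_set 0 (limiting_subdiff \<Psi> x)"
    unfolding gen_concave_KL_at_def by blast
  obtain \<delta> where \<delta>: "\<delta> > 0" "ball w \<delta> \<subseteq> U"
    using U open_contains_ball by blast
  have \<phi>_nonneg: "0 \<le> \<phi> u" if "u \<in> dom_upto \<eta>" for u
    using \<phi> that by (auto simp: Phi_def)
  have C_nonneg: "0 \<le> C"
    using b \<rho> by (simp add: C)

  have step: "2 * d k \<le> C * \<phi> (t k) - C * \<phi> (t (Suc k)) + d (k - 1)"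
    if k: "k \<ge> 2" and near: "dist (z k) w < \<delta>" and small: "ereal (t k) < \<eta>" for k
  \<comment> \<open>If the limit value is already attained, the decrease forces all further steps to vanish.\<close>
  proof (cases "t k = 0")
    case True
    have "t (Suc k) + \<rho> / 2 * (d k)\<^sup>2 \<le> t k" "0 \<le> t (Suc k)"
      using dec[of k] t_nonneg[of "Suc k"] k by (auto simp: t_def)
    moreover have "0 \<le> \<rho> / 2 * (d k)\<^sup>2"
      using \<rho> by simp
    ultimately have "t (Suc k) = 0" "\<rho> / 2 * (d k)\<^sup>2 = 0"
      using True by linarith+
    then show ?thesis
      using True \<rho> by (simp add: d_def)
  next
    case False
    then have pos: "0 < t k"
      using t_nonneg[of k] k by simp
    define e where "e = edist_set 0 (limiting_subdiff \<Psi> (z k))"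
    have "z k \<in> U"
      using near \<delta> by (auto simp: dist_commute)
    then have one: "1 \<le> ereal (left_deriv \<phi> (t k)) * e"
      using KLw[of "z k"] t_eq[of k] k pos small by (simp add: e_def zero_ereal_def)
    have "q (k - 1) \<in> limiting_subdiff \<Psi> (z k)"
      using q(1)[of "k - 1"] k regular_subset_limiting_subdiff[of \<Psi> "z k"] by (auto simp: Suc_diff_le)
    then have "e \<le> ereal (norm (q (k - 1)))"
      unfolding e_def edist_set_def by (rule INF_lower2) simp
    also have "\<dots> \<le> ereal (b * d (k - 1))"
      using q(2)[of "k - 1"] k by simp
    finally have upper: "e \<le> ereal (b * d (k - 1))" .
    have "0 \<le> e"
      unfolding e_def edist_set_def by (rule INF_greatest) simp
    then obtain e' where e': "e = ereal e'" "0 \<le> e'" "e' \<le> b * d (k - 1)"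
      using upper by (cases e) auto
    then have "1 \<le> left_deriv \<phi> (t k) * e'"
      using one by (simp add: one_ereal_def)
    moreover have "0 < left_deriv \<phi> (t k)"
    proof (rule ccontr)
      assume "\<not> 0 < left_deriv \<phi> (t k)"
      then have "left_deriv \<phi> (t k) * e' \<le> 0"
        using e'(2) by (simp add: mult_nonpos_nonneg)
      with \<open>1 \<le> left_deriv \<phi> (t k) * e'\<close> show False
        by simp
    qed
    ultimately have "1 \<le> left_deriv \<phi> (t k) * (b * d (k - 1))"
      using mult_left_mono[OF e'(3), of "left_deriv \<phi> (t k)"] by linarith
    then have "2 * d k \<le> 2 * b / \<rho> * (\<phi> (t k) - \<phi> (t (Suc k))) + d (k - 1)"
      using dec[of k] t_nonneg[of "Suc k"] k b \<rho> pos small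
      by (intro KL_step_estimate[OF conc]) (auto simp: t_def d_def)
    then show ?thesis
      by (simp add: C right_diff_distrib)
  qed

  have small_ev: "\<forall>\<^sub>F k in sequentially. ereal (t k) < \<eta>"
  proof -
    have "(\<lambda>k. ereal (t k)) \<longlonglongrightarrow> ereal 0"
      using t_lim by simp
    then show ?thesis
      using \<eta> by (intro order_tendstoD(2)) (auto simp: zero_ereal_def)
  qed
  have \<phi>_ev: "\<forall>\<^sub>F k in sequentially. \<phi> (t k) < a" if "0 < a" for a
  proof -
    have "(\<phi> \<longlongrightarrow> 0) (at_right 0)"
      using \<phi> by (auto simp: Phi_def continuous_within)
    then have "\<forall>\<^sub>F u in at_right 0. \<phi> u < a"
      using that by (rule order_tendstoD(2))
    then obtain u0 where u0: "0 < u0" "\<And>u. 0 < u \<Longrightarrow> u < u0 \<Longrightarrow> \<phi> u < a"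
      by (auto simp: eventually_at_right_field)
    have "\<forall>\<^sub>F k in sequentially. t k < u0 \<and> 1 \<le> k"
      using order_tendstoD(2)[OF t_lim u0(1)] eventually_ge_at_top by (rule eventually_conj)
    then show ?thesis
    proof eventually_elim
      case (elim k)
      then show ?case
        using u0(2)[of "t k"] t_nonneg[of k] \<phi> that by (cases "t k = 0") (auto simp: Phi_def)
    qed
  qed

  have "\<exists>N\<ge>2. ereal (t N) < \<eta> \<and> dist (z N) w + C * \<phi> (t N) + d (N - 1) < \<delta>"
  proof -
    have ev1: "\<forall>\<^sub>F j in sequentially. dist (z (s j)) w < \<delta> / 3"
      using zs \<delta>(1) by (intro tendstoD) auto
    have "\<forall>\<^sub>F k in sequentially. \<phi> (t k) < \<delta> / (3 * (C + 1))"
      using \<delta> C_nonneg by (intro \<phi>_ev) simp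
    moreover have "(\<lambda>k. d (k - 1)) \<longlonglongrightarrow> 0"
      using d_lim LIMSEQ_imp_Suc[of "\<lambda>k. d (k - 1)"] by simp
    then have "\<forall>\<^sub>F k in sequentially. d (k - 1) < \<delta> / 3"
      using \<delta> by (intro order_tendstoD(2)) auto
    ultimately have "\<forall>\<^sub>F k in sequentially. \<phi> (t k) < \<delta> / (3 * (C + 1)) \<and> d (k - 1) < \<delta> / 3 \<and> ereal (t k) < \<eta>"
      using small_ev by eventually_elim simp
    then have "\<forall>\<^sub>F j in sequentially. \<phi> (t (s j)) < \<delta> / (3 * (C + 1)) \<and> d (s j - 1) < \<delta> / 3 \<and> ereal (t (s j)) < \<eta>"
      by (rule eventually_subseq[OF s])
    with ev1 have "\<forall>\<^sub>F j in sequentially. dist (z (s j)) w < \<delta> / 3 \<and> \<phi> (t (s j)) < \<delta> / (3 * (C + 1))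
        \<and> d (s j - 1) < \<delta> / 3 \<and> ereal (t (s j)) < \<eta>"
      by eventually_elim simp
    then obtain j where j: "dist (z (s j)) w < \<delta> / 3" "\<phi> (t (s j)) < \<delta> / (3 * (C + 1))"
        "d (s j - 1) < \<delta> / 3" "ereal (t (s j)) < \<eta>"
      by (auto simp: eventually_sequentially)
    \<comment> \<open>Dividing by \<open>C + 1\<close> instead of \<open>C\<close> avoids a case distinction on \<open>C = 0\<close>.\<close>
    have "C * \<phi> (t (s j)) \<le> C * (\<delta> / (3 * (C + 1)))"
      using j(2) C_nonneg by (intro mult_left_mono) auto
    also have "\<dots> \<le> \<delta> / 3"
      using C_nonneg \<delta>(1) by (simp add: field_simps)
    finally show ?thesis
      using j s2[of j] by (intro exI[of _ "s j"]) auto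
  qed
  then obtain N where N: "2 \<le> N" "ereal (t N) < \<eta>"
      and room: "dist (z N) w + C * \<phi> (t N) + d (N - 1) < \<delta>"
    by blast
  have small: "ereal (t k) < \<eta>" and t_dom: "t k \<in> dom_upto \<eta>" if "k \<ge> N" for k
  proof -
    have "t k \<le> t N"
      using mono[of N k] N that by (simp add: t_def)
    then show "ereal (t k) < \<eta>"
      using N(2) le_less_trans[of "ereal (t k)" "ereal (t N)" \<eta>] by simp
    then show "t k \<in> dom_upto \<eta>"
      using t_nonneg[of k] N that by (simp add: dom_upto_def)
  qed
  have length: "(\<Sum>k=p..<n. d k) \<le> C * \<phi> (t p) + d (p - 1)"
    if p: "N \<le> p" "p \<le> n" and near: "\<And>k. p \<le> k \<Longrightarrow> k < n \<Longrightarrow> dist (z k) w < \<delta>" for p n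
  proof -
    have "(\<Sum>k=p..<n. d k) \<le> C * \<phi> (t p) - C * \<phi> (t n) + d (p - 1) - d (n - 1)"
      using p N near small by (intro telescoped_length_bound step) auto
    moreover have "0 \<le> C * \<phi> (t n)" "0 \<le> d (n - 1)"
      using C_nonneg \<phi>_nonneg t_dom[of n] p by (auto simp: d_def)
    ultimately show ?thesis
      by linarith
  qed
  have trapped: "dist (z n) w < \<delta>" if "N \<le> n" for n
    using that
  proof (induction n rule: less_induct)
    case (less n)
    have "dist (z n) (z N) \<le> (\<Sum>k=N..<n. d k)"
      using dist_le_sum_increments[OF less.prems, of z] by (simp add: d_def)
    also have "\<dots> \<le> C * \<phi> (t N) + d (N - 1)"
      using less by (intro length) auto
    finally show ?case
      using room dist_triangle[of "z n" w "z N"] by linarith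
  qed

  have "summable d"
  proof (rule summableI_nonneg_bounded)
    fix n
    have "(\<Sum>k<n. d k) \<le> (\<Sum>k<N + n. d k)"
      by (rule sum_mono2) (auto simp: d_def)
    also have "\<dots> = (\<Sum>k<N. d k) + (\<Sum>k=N..<N + n. d k)"
      by (simp add: lessThan_atLeast0 sum.atLeastLessThan_concat)
    also have "\<dots> \<le> (\<Sum>k<N. d k) + (C * \<phi> (t N) + d (N - 1))"
      using trapped by (intro add_left_mono length) auto
    finally show "(\<Sum>k<n. d k) \<le> (\<Sum>k<N. d k) + (C * \<phi> (t N) + d (N - 1))" .
  qed (simp add: d_def)
  then have "summable (\<lambda>k. z (Suc k) - z k)"
    unfolding d_def by (rule summable_norm_cancel)
  then have "convergent (\<lambda>n. z n - z 0)"
    by (simp add: summable_iff_convergent sum_lessThan_telescope)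
  then have "convergent z"
    by (simp add: convergent_diff_const_right_iff)
  then have "z \<longlonglongrightarrow> w"
    using LIMSEQ_subseq_LIMSEQ[OF _ s] LIMSEQ_unique[OF zs] by (fastforce simp: convergent_def o_def)
  then show ?thesis
  proof (rule that[OF _ stationary _ \<eta> \<phi>])
    show "1 \<le> N - 1"
      using N by simp
    fix p assume "N - 1 + 1 \<le> p"
    then have p: "N \<le> p" "1 \<le> p" "Suc (p - 1) = p"
      using N by auto
    show "0 \<le> \<Psi> (z p) - \<Psi> w" "\<Psi> (z p) - \<Psi> w < \<eta>"
      using p small[of p] t_nonneg[of p] by (simp_all add: t_eq)
    fix n assume "p \<le> n"
    then show "(\<Sum>k=p..<n. norm (z (Suc k) - z k))
           \<le> C * \<phi> (real_of_ereal (\<Psi> (z p) - \<Psi> w)) + norm (z p - z (p - 1))"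
      using length[of p n] trapped p by (simp add: t_eq d_def)
  qed
qed

section \<open>One step of the alternating scheme\<close>

text \<open>The minorants of \<open>f\<close> and \<open>g\<close> produced by the two half steps add up, since \<open>\<parallel>(u, v)\<parallel>\<^sup>2\<close> is the sum
  of the squared norms of the blocks.\<close>

lemma prox_pair_minorant:
  fixes f :: "'a::real_inner \<Rightarrow> ereal" and g :: "'b::real_inner \<Rightarrow> ereal"
  assumes f: "proper f" and g: "proper g"
    and Psi: "\<And>u v. \<Psi> (u, v) = f u + g v + ereal (F (u, v))"
    and c: "0 < c" "c \<le> K" and d: "0 < d" "d \<le> K"
    and x': "x' \<in> prox f c (x - (1 / c) *\<^sub>R Gx)" and y': "y' \<in> prox g d (y - (1 / d) *\<^sub>R Gy)"
  shows "quad_minorant \<Psi> F K ((c *\<^sub>R (x - x') - Gx, d *\<^sub>R (y - y') - Gy) + grad F (x', y')) (x', y')"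
  unfolding quad_minorant_def
proof (intro conjI allI)
  note pf = prox_minorant[OF f c(1) x'] and pg = prox_minorant[OF g d(1) y']
  show "\<bar>\<Psi> (x', y')\<bar> \<noteq> \<infinity>"
    using pf(1) pg(1) by (auto simp: Psi)
  fix w :: "'a \<times> 'b"
  obtain u v where w: "w = (u, v)"
    by (cases w)
  define A where "A = (c *\<^sub>R (x - x') - Gx) \<bullet> (u - x')"
  define B where "B = (d *\<^sub>R (y - y') - Gy) \<bullet> (v - y')"
  have "c / 2 * (norm (u - x'))\<^sup>2 \<le> K / 2 * (norm (u - x'))\<^sup>2"
    and "d / 2 * (norm (v - y'))\<^sup>2 \<le> K / 2 * (norm (v - y'))\<^sup>2"
    using c d by (auto intro!: mult_right_mono)
  moreover have "K / 2 * (norm (w - (x', y')))\<^sup>2 = K / 2 * (norm (u - x'))\<^sup>2 + K / 2 * (norm (v - y'))\<^sup>2"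
    by (simp add: w norm_Pair algebra_simps)
  ultimately have "A + B - K / 2 * (norm (w - (x', y')))\<^sup>2
      \<le> (A - c / 2 * (norm (u - x'))\<^sup>2) + (B - d / 2 * (norm (v - y'))\<^sup>2)"
    by linarith
  moreover have "((c *\<^sub>R (x - x') - Gx, d *\<^sub>R (y - y') - Gy) + grad F (x', y')) \<bullet> (w - (x', y'))
      = A + B + grad F (x', y') \<bullet> (w - (x', y'))"
    by (simp add: inner_add_left w A_def B_def)
  moreover have "f x' + ereal (A - c / 2 * (norm (u - x'))\<^sup>2) \<le> f u"
    and "g y' + ereal (B - d / 2 * (norm (v - y'))\<^sup>2) \<le> g v"
    using pf(2) pg(2) by (simp_all add: A_def B_def)
  ultimately show "\<Psi> (x', y') + ereal (((c *\<^sub>R (x - x') - Gx, d *\<^sub>R (y - y') - Gy) + grad F (x', y'))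
      \<bullet> (w - (x', y')) - K / 2 * (norm (w - (x', y')))\<^sup>2
      + (F w - F (x', y') - grad F (x', y') \<bullet> (w - (x', y')))) \<le> \<Psi> w"
    using pf(1) pg(1) unfolding w Psi
    by (cases "f x'"; cases "g y'"; cases "f u"; cases "g v") auto
qed

text \<open>The subgradient consists of the two proximal displacements and of the differences between the
  partial gradients at the new point and those used in the half steps. The first block used the
  gradient at \<open>(x, y)\<close>, the second at \<open>(x', y)\<close>, which again lies in the product \<open>S \<times> T\<close>; each block
  therefore contributes at most \<open>M + K\<close> times the length of the step.\<close>

lemma palm_residual_bound:
  fixes F :: "'a::euclidean_space \<times> 'b::euclidean_space \<Rightarrow> real"
  assumes F: "C1_fun F" and lip: "M-lipschitz_on (S \<times> T) (grad F)"
    and mem: "x \<in> S" "x' \<in> S" "y \<in> T" "y' \<in> T"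
    and c: "0 < c" "c \<le> K" and d: "0 < d" "d \<le> K"
  shows "norm ((c *\<^sub>R (x - x') - grad_x F x y, d *\<^sub>R (y - y') - grad_y F x' y) + grad F (x', y'))
    \<le> (2 * M + 2 * K) * norm ((x', y') - (x, y))"
proof -
  let ?\<Delta> = "norm ((x', y') - (x, y))"
  have "0 \<le> M"
    using lip by (rule lipschitz_on_nonneg)
  have norm_fst: "norm (fst p) \<le> norm p" and norm_snd: "norm (snd p) \<le> norm p" for p :: "'a \<times> 'b"
    using norm_fst_le[of "fst p" "snd p"] norm_snd_le[of "snd p" "fst p"] by simp_all
  have dx: "norm (x - x') \<le> ?\<Delta>" and dy: "norm (y - y') \<le> ?\<Delta>"
    using norm_fst[of "(x', y') - (x, y)"] norm_snd[of "(x', y') - (x, y)"]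
    by (simp_all add: norm_minus_commute)
  have "norm (fst (grad F (x', y') - grad F (x, y))) \<le> M * ?\<Delta>"
    using lipschitz_onD[OF lip, of "(x', y')" "(x, y)"] mem
      norm_fst[of "grad F (x', y') - grad F (x, y)"]
    by (simp add: dist_norm)
  moreover have "norm (c *\<^sub>R (x - x')) \<le> K * ?\<Delta>"
    using c dx by (simp add: mult_mono)
  ultimately have fst_block: "norm (c *\<^sub>R (x - x') + fst (grad F (x', y') - grad F (x, y))) \<le> (M + K) * ?\<Delta>"
    using norm_triangle_le[of "c *\<^sub>R (x - x')" "fst (grad F (x', y') - grad F (x, y))" "(M + K) * ?\<Delta>"]
    by (simp add: distrib_right)
  have "norm (snd (grad F (x', y') - grad F (x', y))) \<le> M * norm (y' - y)"
    using lipschitz_onD[OF lip, of "(x', y')" "(x', y)"] mem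
      norm_snd[of "grad F (x', y') - grad F (x', y)"]
    by (simp add: dist_norm norm_Pair)
  also have "\<dots> \<le> M * ?\<Delta>"
    using \<open>0 \<le> M\<close> dy by (simp add: mult_left_mono norm_minus_commute)
  finally have "norm (snd (grad F (x', y') - grad F (x', y))) \<le> M * ?\<Delta>" .
  moreover have "norm (d *\<^sub>R (y - y')) \<le> K * ?\<Delta>"
    using d dy by (simp add: mult_mono)
  ultimately have snd_block: "norm (d *\<^sub>R (y - y') + snd (grad F (x', y') - grad F (x', y))) \<le> (M + K) * ?\<Delta>"
    using norm_triangle_le[of "d *\<^sub>R (y - y')" "snd (grad F (x', y') - grad F (x', y))" "(M + K) * ?\<Delta>"]
    by (simp add: distrib_right)
  have "(c *\<^sub>R (x - x') - grad_x F x y, d *\<^sub>R (y - y') - grad_y F x' y) + grad F (x', y')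
      = (c *\<^sub>R (x - x') + fst (grad F (x', y') - grad F (x, y)),
         d *\<^sub>R (y - y') + snd (grad F (x', y') - grad F (x', y)))"
    by (simp add: prod_eq_iff grad_x_eq_fst_grad(2)[OF F] grad_y_eq_snd_grad(2)[OF F])
  also have "norm \<dots> \<le> (M + K) * ?\<Delta> + (M + K) * ?\<Delta>"
    by (rule order_trans[OF norm_Pair_le add_mono[OF fst_block snd_block]])
  finally show ?thesis
    by (simp add: algebra_simps)
qed

text \<open>The second half step starts at \<open>(x', y)\<close>, where the first one ends, so the two decreases can be
  added: the intermediate value \<open>F (x', y)\<close> cancels.\<close>

lemma palm_descent:
  fixes F :: "'a::euclidean_space \<times> 'b::euclidean_space \<Rightarrow> real"
  assumes f: "proper f" and g: "proper g" and F: "C1_fun F"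
    and Psi: "\<And>u v. \<Psi> (u, v) = f u + g v + ereal (F (u, v))"
    and lip: "L1-lipschitz_on UNIV (\<lambda>u. grad_x F u y)" "L2-lipschitz_on UNIV (\<lambda>v. grad_y F x' v)"
    and c: "0 < c" "\<rho> \<le> c - L1" and d: "0 < d" "\<rho> \<le> d - L2"
    and x': "x' \<in> prox f c (x - (1 / c) *\<^sub>R grad_x F x y)"
    and y': "y' \<in> prox g d (y - (1 / d) *\<^sub>R grad_y F x' y)"
  shows "\<Psi> (x', y') + ereal (\<rho> / 2 * (norm ((x', y') - (x, y)))\<^sup>2) \<le> \<Psi> (x, y)"
proof -
  define X Y where "X = (c - L1) / 2 * (norm (x' - x))\<^sup>2" and "Y = (d - L2) / 2 * (norm (y' - y))\<^sup>2"
  have "\<rho> / 2 * (norm ((x', y') - (x, y)))\<^sup>2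
      = \<rho> / 2 * (norm (x' - x))\<^sup>2 + \<rho> / 2 * (norm (y' - y))\<^sup>2"
    by (simp add: norm_Pair algebra_simps)
  moreover have "\<rho> / 2 * (norm (x' - x))\<^sup>2 \<le> X" "\<rho> / 2 * (norm (y' - y))\<^sup>2 \<le> Y"
    unfolding X_def Y_def using c d by (auto intro!: mult_right_mono)
  ultimately have le: "\<rho> / 2 * (norm ((x', y') - (x, y)))\<^sup>2 \<le> X + Y"
    by linarith
  have "f x' + ereal (F (x', y)) + ereal X \<le> f x + ereal (F (x, y))"
    using prox_gradient_descent[where h = "\<lambda>u. F (u, y)" and G = "\<lambda>u. grad_x F u y",
        OF f c(1) x' grad_x_eq_fst_grad(1)[OF F] lip(1)] unfolding X_def .
  moreover have "g y' + ereal (F (x', y')) + ereal Y \<le> g y + ereal (F (x', y))"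
    using prox_gradient_descent[where h = "\<lambda>v. F (x', v)" and G = "\<lambda>v. grad_y F x' v",
        OF g d(1) y' grad_y_eq_snd_grad(1)[OF F] lip(2)] unfolding Y_def .
  moreover have "\<bar>f x'\<bar> \<noteq> \<infinity>" "\<bar>g y'\<bar> \<noteq> \<infinity>" "f x \<noteq> -\<infinity>" "g y \<noteq> -\<infinity>"
    using prox_minorant(1)[OF f c(1) x'] prox_minorant(1)[OF g d(1) y'] f g
    by (auto simp: proper_def)
  ultimately have "\<Psi> (x', y') + ereal (X + Y) \<le> \<Psi> (x, y)"
    unfolding Psi by (cases "f x'"; cases "g y'"; cases "f x"; cases "g y") auto
  then show ?thesis
    using le by (meson add_left_mono ereal_less_eq(3) order_trans)
qed

section \<open>Convergence of PALM\<close>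

lemma infsum_le_of_tail_bound:
  fixes d :: "nat \<Rightarrow> real"
  assumes "\<And>k. 0 \<le> d k" and tail: "\<And>n. l + 1 \<le> n \<Longrightarrow> (\<Sum>k=l+1..<n. d k) \<le> B"
  shows "d summable_on {1..}" and "(\<Sum>\<^sub>\<infinity>k\<in>{1..}. d k) \<le> (\<Sum>k=1..l. d k) + B"
proof -
  have bound: "sum d S \<le> (\<Sum>k=1..l. d k) + B" if S: "finite S" "S \<subseteq> {1..}" for S
  proof -
    obtain m where m: "\<forall>k\<in>S. k < m"
      using S(1) finite_nat_set_iff_bounded by blast
    have "S \<subseteq> {1..<m + (l + 1)}"
    proof
      fix k assume "k \<in> S"
      with m S(2) show "k \<in> {1..<m + (l + 1)}"
        by fastforce
    qed
    then have "sum d S \<le> (\<Sum>k=1..<m + (l + 1). d k)"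
      using assms(1) by (intro sum_mono2) auto
    also have "\<dots> = (\<Sum>k=1..<l + 1. d k) + (\<Sum>k=l+1..<m + (l + 1). d k)"
      by (rule sum.atLeastLessThan_concat[symmetric]) auto
    also have "\<dots> \<le> (\<Sum>k=1..l. d k) + B"
      using tail[of "m + (l + 1)"] by (simp add: atLeastLessThanSuc_atLeastAtMost)
    finally show ?thesis .
  qed
  show summ: "d summable_on {1..}"
    using assms(1) bound by (intro nonneg_bdd_above_summable_on bdd_aboveI2) auto
  show "(\<Sum>\<^sub>\<infinity>k\<in>{1..}. d k) \<le> (\<Sum>k=1..l. d k) + B"
    using bound by (intro infsum_le_finite_sums[OF summ])
qed

theorem theorem4p5:
  fixes f :: "real ^ 'n \<Rightarrow> ereal" and g :: "real ^ 'm \<Rightarrow> ereal"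
    and F :: "(real ^ 'n) \<times> (real ^ 'm) \<Rightarrow> real"
    and \<Psi> :: "(real ^ 'n) \<times> (real ^ 'm) \<Rightarrow> ereal"
    and L1 :: "real ^ 'm \<Rightarrow> real" and L2 :: "real ^ 'n \<Rightarrow> real"
    and x :: "nat \<Rightarrow> real ^ 'n" and y :: "nat \<Rightarrow> real ^ 'm"
    and z :: "nat \<Rightarrow> (real ^ 'n) \<times> (real ^ 'm)"
    and B1 :: "(real ^ 'n) set" and B2 :: "(real ^ 'm) set"
    and \<gamma>1 \<gamma>2 lam1m lam1p lam2m lam2p M \<rho>1 \<rho>2 C :: real
  assumes f: "proper f" "lsc f"
    and g: "proper g" "lsc g"
    and F: "C1_fun F"
    and Psi: "\<And>u v. \<Psi> (u, v) = f u + g v + ereal (F (u, v))"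
    and KL: "gen_concave_KL \<Psi>"
    and A1: "(INF w. \<Psi> w) > -\<infinity>" "(INF u. f u) > -\<infinity>" "(INF v. g v) > -\<infinity>"
    and A2: "\<And>v. (L1 v)-lipschitz_on UNIV (\<lambda>u. grad_x F u v)"
            "\<And>u. (L2 u)-lipschitz_on UNIV (\<lambda>v. grad_y F u v)"
    and A3: "lam1m > 0" "lam1p > 0" "lam2m > 0" "lam2p > 0"
            "(INF k\<in>{1..}. ereal (L1 (y k))) \<ge> ereal lam1m"
            "(INF k\<in>{1..}. ereal (L2 (x k))) \<ge> ereal lam2m"
            "(SUP k\<in>{1..}. ereal (L1 (y k))) \<le> ereal lam1p"
            "(SUP k\<in>{1..}. ereal (L2 (x k))) \<le> ereal lam2p"
    and A4: "\<And>S T. bounded S \<Longrightarrow> bounded T \<Longrightarrow> \<exists>K>0. K-lipschitz_on (S \<times> T) (grad F)"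
    and gam: "\<gamma>1 > 1" "\<gamma>2 > 1"
    and palm: "palm_sequence f g F L1 L2 \<gamma>1 \<gamma>2 x y"
    and z: "\<And>k. z k = (x k, y k)"
    and bdd: "bounded (range z)"
    and M: "bounded B1" "bounded B2" "\<And>k. k \<ge> 1 \<Longrightarrow> z k \<in> B1 \<times> B2"
           "M > 0" "M-lipschitz_on (B1 \<times> B2) (grad F)"
    and rho1: "\<rho>1 = min ((\<gamma>1 - 1) * lam1m) ((\<gamma>2 - 1) * lam2m)"
    and rho2: "\<rho>2 = max (\<gamma>1 * lam1p) (\<gamma>2 * lam2p)"
    and C: "C = 2 * (2 * M + 3 * \<rho>2) / \<rho>1"
  shows "\<exists>zs. z \<longlonglongrightarrow> zs \<and> 0 \<in> limiting_subdiff \<Psi> zs \<and>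
    (\<exists>(l::nat) (\<eta>::ereal) \<phi>. l \<ge> 1 \<and> 0 < \<eta> \<and> \<phi> \<in> Phi \<eta> \<and>
       (\<forall>p\<ge>l+1. 0 \<le> \<Psi> (z p) - \<Psi> zs \<and> \<Psi> (z p) - \<Psi> zs < \<eta>) \<and>
       (\<forall>p\<ge>l+1. \<forall>q\<ge>1. (\<Sum>k=p..p+q. norm (z (k+1) - z k))
           \<le> C * \<phi> (real_of_ereal (\<Psi> (z p) - \<Psi> zs)) + norm (z p - z (p-1))) \<and>
       (\<lambda>k. norm (z (k+1) - z k)) summable_on {1..} \<and>
       (\<Sum>\<^sub>\<infinity>k\<in>{1..}. norm (z (k+1) - z k))
           \<le> (norm (z (l+1) - z l) + (\<Sum>k=1..l. norm (z (k+1) - z k)))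
              + C * \<phi> (real_of_ereal (\<Psi> (z (l+1)) - \<Psi> zs)))"
proof -
  have L1: "lam1m \<le> L1 (y k)" "L1 (y k) \<le> lam1p" and L2: "lam2m \<le> L2 (x k)" "L2 (x k) \<le> lam2p"
    if "k \<ge> 1" for k
    using A3(5-8) that by (auto simp: le_INF_iff SUP_le_iff)
  have \<rho>1: "0 < \<rho>1"
    using A3(1,3) gam by (simp add: rho1)
  have \<rho>2: "0 < \<rho>2"
    using A3(2,4) gam by (simp add: rho2 less_max_iff_disj)
  define b where "b = 2 * M + 3 * \<rho>2"
  have b: "0 \<le> b"
    using M(4) \<rho>2 by (simp add: b_def)
  define q where "q k =
      ((\<gamma>1 * L1 (y k)) *\<^sub>R (x k - x (Suc k)) - grad_x F (x k) (y k),
       (\<gamma>2 * L2 (x (Suc k))) *\<^sub>R (y k - y (Suc k)) - grad_y F (x (Suc k)) (y k)) + grad F (z (Suc k))" for k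

  have steps: "0 < \<gamma>1 * L1 (y k)" "0 < \<gamma>2 * L2 (x (Suc k))"
    and x_step: "x (Suc k) \<in> prox f (\<gamma>1 * L1 (y k))
          (x k - (1 / (\<gamma>1 * L1 (y k))) *\<^sub>R grad_x F (x k) (y k))"
    and y_step: "y (Suc k) \<in> prox g (\<gamma>2 * L2 (x (Suc k)))
          (y k - (1 / (\<gamma>2 * L2 (x (Suc k)))) *\<^sub>R grad_y F (x (Suc k)) (y k))" for k
    using palm by (auto simp: palm_sequence_def Let_def)
  have lower: "\<rho>1 \<le> \<gamma>1 * L1 (y k) - L1 (y k)" "\<rho>1 \<le> \<gamma>2 * L2 (x (Suc k)) - L2 (x (Suc k))"
    and upper: "\<gamma>1 * L1 (y k) \<le> \<rho>2" "\<gamma>2 * L2 (x (Suc k)) \<le> \<rho>2" if "k \<ge> 1" for k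
  proof -
    have "(\<gamma>1 - 1) * lam1m \<le> (\<gamma>1 - 1) * L1 (y k)" "(\<gamma>2 - 1) * lam2m \<le> (\<gamma>2 - 1) * L2 (x (Suc k))"
      using gam L1[OF that] L2[of "Suc k"] by (auto intro!: mult_left_mono)
    then show "\<rho>1 \<le> \<gamma>1 * L1 (y k) - L1 (y k)" "\<rho>1 \<le> \<gamma>2 * L2 (x (Suc k)) - L2 (x (Suc k))"
      by (auto simp: rho1 left_diff_distrib)
    have "\<gamma>1 * L1 (y k) \<le> \<gamma>1 * lam1p" "\<gamma>2 * L2 (x (Suc k)) \<le> \<gamma>2 * lam2p"
      using gam L1[OF that] L2[of "Suc k"] by (auto intro!: mult_left_mono)
    then show "\<gamma>1 * L1 (y k) \<le> \<rho>2" "\<gamma>2 * L2 (x (Suc k)) \<le> \<rho>2"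
      by (auto simp: rho2)
  qed
  have minorant: "quad_minorant \<Psi> F \<rho>2 (q k) (z (Suc k))" if "k \<ge> 1" for k
    unfolding q_def z
    by (rule prox_pair_minorant[OF f(1) g(1) Psi steps(1) upper(1)[OF that]
          steps(2) upper(2)[OF that] x_step y_step])
  have descent: "\<Psi> (z (Suc k)) + ereal (\<rho>1 / 2 * (norm (z (Suc k) - z k))\<^sup>2) \<le> \<Psi> (z k)"
    if "k \<ge> 1" for k
    unfolding z
    by (rule palm_descent[OF f(1) g(1) F Psi A2 steps(1) lower(1)[OF that]
          steps(2) lower(2)[OF that] x_step y_step])
  have residual: "norm (q k) \<le> b * norm (z (Suc k) - z k)" if "k \<ge> 1" for k
  proof -
    have "norm (q k) \<le> (2 * M + 2 * \<rho>2) * norm (z (Suc k) - z k)"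
      unfolding q_def z using that M(3)[of k] M(3)[of "Suc k"]
      by (intro palm_residual_bound[OF F M(5)] steps upper) (auto simp: z)
    \<comment> \<open>The constant \<open>C\<close> of the conclusion is built from \<open>b\<close>, which leaves a slack of \<open>\<rho>2\<close>.\<close>
    also have "\<dots> \<le> b * norm (z (Suc k) - z k)"
      using \<rho>2 by (intro mult_right_mono) (auto simp: b_def)
    finally show ?thesis .
  qed
  have fin: "\<bar>\<Psi> (z k)\<bar> \<noteq> \<infinity>" if "k \<ge> 1" for k
    using that prox_minorant(1)[OF f(1) steps(1) x_step, of "k - 1"]
      prox_minorant(1)[OF g(1) steps(2) y_step, of "k - 1"]
    by (auto simp: z Psi)
  have cont: "limsup (\<lambda>j. \<Psi> (z (s j))) \<le> \<Psi> w"
    if "strict_mono s" and s2: "\<And>j. 2 \<le> s j" and lim: "(\<lambda>j. z (s j)) \<longlonglongrightarrow> w" for s w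
  proof (rule quad_minorant_Limsup_le[OF F _ _ lim])
    have pred: "Suc (s j - 1) = s j" "1 \<le> s j - 1" for j
      using s2[of j] by auto
    show "quad_minorant \<Psi> F \<rho>2 (q (s j - 1)) (z (s j))" for j
      using minorant[OF pred(2)[of j]] by (simp only: pred(1))
    obtain B where B: "\<And>k. norm (z k) \<le> B"
      using bdd by (auto simp: bounded_iff)
    have "norm (q (s j - 1)) \<le> b * (B + B)" for j
    proof -
      \<comment> \<open>Boundedness of the iterates alone bounds the steps, hence the subgradients.\<close>
      have "norm (z (Suc (s j - 1)) - z (s j - 1)) \<le> B + B"
        by (rule order_trans[OF norm_triangle_ineq4 add_mono[OF B B]])
      then show ?thesis
        using residual[OF pred(2)[of j]] mult_left_mono[OF _ b] order_trans by blast
    qed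
    then show "bounded (range (\<lambda>j. q (s j - 1)))"
      by (auto simp: bounded_iff)
  qed
  have error: "\<exists>v\<in>regular_subdiff \<Psi> (z (Suc k)). norm v \<le> b * norm (z (Suc k) - z k)" if "k \<ge> 1" for k
    using quad_minorant_imp_regular_subdiff[OF F minorant[OF that]] residual[OF that] by (rule bexI[rotated])
  have C_eq: "C = 2 * b / \<rho>1"
    by (simp add: C b_def)
  obtain w l \<eta> \<phi> where w: "z \<longlonglongrightarrow> w" "0 \<in> limiting_subdiff \<Psi> w"
    and l: "l \<ge> 1" "0 < \<eta>" "\<phi> \<in> Phi \<eta>"
    and gap: "\<And>p. p \<ge> l + 1 \<Longrightarrow> 0 \<le> \<Psi> (z p) - \<Psi> w"
      "\<And>p. p \<ge> l + 1 \<Longrightarrow> \<Psi> (z p) - \<Psi> w < \<eta>"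
    and len: "\<And>p n. p \<ge> l + 1 \<Longrightarrow> p \<le> n \<Longrightarrow> (\<Sum>k=p..<n. norm (z (Suc k) - z k))
           \<le> C * \<phi> (real_of_ereal (\<Psi> (z p) - \<Psi> w)) + norm (z p - z (p - 1))"
  proof -
    show thesis
      by (rule KL_descent_sequence_converges[OF KL \<rho>1 b bdd _ _ _ _ C_eq])
        (fact fin descent error cont that)+
  qed
  define T where "T = C * \<phi> (real_of_ereal (\<Psi> (z (l + 1)) - \<Psi> w))"
  have tail: "(\<Sum>k=l+1..<n. norm (z (Suc k) - z k)) \<le> T + norm (z (l + 1) - z l)" if "l + 1 \<le> n" for n
    using len[OF order_refl that] by (simp add: T_def)
  have "(\<lambda>k. norm (z (k+1) - z k)) summable_on {1..}"
    and "(\<Sum>\<^sub>\<infinity>k\<in>{1..}. norm (z (k+1) - z k))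
      \<le> (norm (z (l+1) - z l) + (\<Sum>k=1..l. norm (z (k+1) - z k))) + T"
    using infsum_le_of_tail_bound[OF _ tail] by (simp_all add: algebra_simps)
  moreover have "(\<Sum>k=p..p+i. norm (z (k+1) - z k))
      \<le> C * \<phi> (real_of_ereal (\<Psi> (z p) - \<Psi> w)) + norm (z p - z (p-1))" if "p \<ge> l + 1" for p i
    using len[OF that, of "p + i + 1"] by (simp add: atLeastLessThanSuc_atLeastAtMost)
  ultimately show ?thesis
    using w l gap unfolding T_def by (intro exI[of _ w] exI[of _ l] exI[of _ \<eta>] exI[of _ \<phi>] conjI) simp_all
qed

end
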